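(* Let $\Omega\subset\mathbb{R}^2$ be the interior of a simple polygon, let $\mathscr{T}$ be a triangulation of $\overline{\Omega}$ with vertices $V$, boundary vertices $V_B$ and edges $E$, and let $\sigma\in PC_+(\mathscr{T})$. Then there is a unique function $\gamma:E\to\mathbb{R}$ such that the resistor network $(V,V_B,E,\gamma)$ satisfies $\tilde L(\gamma)=L(\sigma)$ and $\Lambda_\gamma=\Lambda_\sigma^{\mathrm{FEM}}$.
   Context: Triangulation: a finite set $\mathscr{T}$ of closed (nondegenerate) triangles in $\mathbb{R}^2$ with union $\overline\Omega$, such that two distinct triangles are either disjoint or meet in exactly one common vertex or one full common edge. $V=\{x_1,\dots,x_N\}$ is the set of all vertices, labeled so that $V_B=\{x_1,\dots,x_B\}=V\cap\partial\Omega$. $E$ is the set of unordered pairs $\{x_j,x_k\}$ that are sides of triangles of $\mathscr{T}$. $PC(\mathscr{T})$ is the set of $\sigma\in L^\infty(\Omega;\mathbb{R}^{2\times2})$ that are equal to a constant symmetric matrix in the interior of each triangle; $PC_+(\mathscr{T})$ is the subset of those that are positive definite on each triangle. FEM model: $v_k:\overline\Omega\to\mathbb{R}$ is the continuous function, affine on each triangle, with $v_k(x_k)=1$ and $v_k(x_j)=0$ for $j\ne k$. $L(\sigma)=(l_{jk})_{j,k=1}^N$ has $l_{jk}=\delta_{jk}$ for $1\le j\le B$ and $l_{jk}=\int_\Omega\sigma\nabla v_j\cdot\nabla v_k\,dx$ for $B+1\le j\le N$. If $L(\sigma)$ is invertible (true for $\sigma\in PC_+(\mathscr{T})$), the FEM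 Dirichlet-to-Neumann map $\Lambda_\sigma^{\mathrm{FEM}}:\mathbb{R}^B\to\mathbb{R}^B$ is $(\Lambda_\sigma^{\mathrm{FEM}}f)_j=\sum_{k=1}^N\big(\int_\Omega\sigma\nabla v_j\cdot\nabla v_k\,dx\big)u_k$, $1\le j\le B$, where $u\in\mathbb{R}^N$ solves $L(\sigma)u=(f,0)^t$. Resistor network: a graph $(V,E)$ with boundary vertices $V_B$ and $\gamma:E\to\mathbb{R}$. Write $\gamma_{jk}=\gamma(\{x_j,x_k\})$, with $\gamma_{jk}=0$ if $\{x_j,x_k\}\notin E$. $\tilde L(\gamma)=(\tilde l_{jk})_{j,k=1}^N$ has $\tilde l_{jk}=\delta_{jk}$ for $j\le B$; for $j\ge B+1$, $\tilde l_{jj}=\sum_{k\neq j}\gamma_{jk}$ and $\tilde l_{jk}=-\gamma_{jk}$ for $k\ne j$. If $\tilde L(\gamma)$ is invertible, $(\Lambda_\gamma f)_j=\sum_{k\ne j}\gamma_{jk}(u_j-u_k)$, $1\le j\le B$, where $\tilde L(\gamma)u=(f,0)^t$. *)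

theory Defs
  imports "Jordan_Normal_Form.Matrix" "HOL-Analysis.Analysis"
begin

text \<open>
  The plane is \<^typ>\<open>real^2\<close>. Vectors and matrices whose size depends on the number of vertices are
  those of \<^theory>\<open>Jordan_Normal_Form.Matrix\<close>. Labels are 0-based: the vertices are
  \<open>x 0, \<dots>, x (N - 1)\<close>, and \<open>x 0, \<dots>, x (B - 1)\<close> are the ones on the boundary.
\<close>


section \<open>Simple polygons and triangulations\<close>

fun polygonal_path :: "(real^2) list \<Rightarrow> real \<Rightarrow> real^2" where
  "polygonal_path [] = linepath 0 0"
| "polygonal_path [a] = linepath a a"
| "polygonal_path [a, b] = linepath a b"
| "polygonal_path (a # b # c # ps) = linepath a b +++ polygonal_path (b # c # ps)"

definition simple_polygon_interior :: "(real^2) set \<Rightarrow> bool" where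
  "simple_polygon_interior \<Omega> \<longleftrightarrow>
     (\<exists>ps. let g = polygonal_path ps in
        simple_path g \<and> pathfinish g = pathstart g \<and> \<Omega> = inside (path_image g))"

definition triangulation_of :: "(real^2) set set \<Rightarrow> (real^2) set \<Rightarrow> bool" where
  "triangulation_of T \<Omega> \<longleftrightarrow>
     finite T \<and> (\<forall>t\<in>T. 2 simplex t) \<and> \<Union>T = closure \<Omega> \<and>
     (\<forall>s\<in>T. \<forall>t\<in>T. s \<noteq> t \<longrightarrow>
        s \<inter> t = {} \<or>
        (\<exists>p. s \<inter> t = {p} \<and> p extreme_point_of s \<and> p extreme_point_of t) \<or>
        (s \<inter> t) edge_of s \<and> (s \<inter> t) edge_of t)"

definition tri_vertices :: "(real^2) set set \<Rightarrow> (real^2) set" where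
  "tri_vertices T = {p. \<exists>t\<in>T. p extreme_point_of t}"

definition tri_edges :: "(real^2) set set \<Rightarrow> (real^2) set set" where
  "tri_edges T = {{p, q} | p q. \<exists>t\<in>T. closed_segment p q edge_of t}"

definition vertex_labelling ::
  "(real^2) set \<Rightarrow> (real^2) set set \<Rightarrow> nat \<Rightarrow> nat \<Rightarrow> (nat \<Rightarrow> real^2) \<Rightarrow> bool" where
  "vertex_labelling \<Omega> T N B x \<longleftrightarrow>
     bij_betw x {..<N} (tri_vertices T) \<and> B \<le> N \<and>
     x ` {..<B} = tri_vertices T \<inter> frontier \<Omega>"


section \<open>Piecewise constant conductivities\<close>

text \<open>
  Elements of \<open>L\<^sup>\<infinity>\<close> are given by representatives, so all pointwise conditions are required
  almost everywhere only.
\<close>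

definition PC :: "(real^2) set \<Rightarrow> (real^2) set set \<Rightarrow> (real^2 \<Rightarrow> real^2^2) set" where
  "PC \<Omega> T = {\<sigma>. \<sigma> \<in> borel_measurable (lebesgue_on \<Omega>) \<and>
     (\<exists>C. AE p in lebesgue_on \<Omega>. norm (\<sigma> p) \<le> C) \<and>
     (\<forall>t\<in>T. \<exists>A. transpose A = A \<and> (AE p in lebesgue_on (interior t). \<sigma> p = A))}"

definition positive_definite :: "real^2^2 \<Rightarrow> bool" where
  "positive_definite A \<longleftrightarrow> (\<forall>\<xi>. \<xi> \<noteq> 0 \<longrightarrow> inner \<xi> (A *v \<xi>) > 0)"

definition PC_plus :: "(real^2) set \<Rightarrow> (real^2) set set \<Rightarrow> (real^2 \<Rightarrow> real^2^2) set" where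
  "PC_plus \<Omega> T = {\<sigma> \<in> PC \<Omega> T.
     \<forall>t\<in>T. AE p in lebesgue_on (interior t). positive_definite (\<sigma> p)}"


section \<open>The FEM model\<close>

text \<open>
  The requirement that the hat function vanish off \<open>closure \<Omega>\<close> makes it unique as a function on the
  whole plane; it does not affect the values on \<open>closure \<Omega>\<close>.
\<close>

definition hat ::
  "(real^2) set \<Rightarrow> (real^2) set set \<Rightarrow> nat \<Rightarrow> (nat \<Rightarrow> real^2) \<Rightarrow> nat \<Rightarrow> real^2 \<Rightarrow> real" where
  "hat \<Omega> T N x k = (THE v.
     continuous_on (closure \<Omega>) v \<and>
     (\<forall>t\<in>T. \<exists>a b. \<forall>p\<in>t. v p = inner a p + b) \<and>
     (\<forall>j<N. v (x j) = (if j = k then 1 else 0)) \<and>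
     (\<forall>p. p \<notin> closure \<Omega> \<longrightarrow> v p = 0))"

text \<open>
  On the sides of the triangles, a null set, the gradient of a hat function may fail to exist;
  \<open>grad\<close> then has an unspecified value, which does not affect the integrals below.
\<close>

definition grad :: "(real^2 \<Rightarrow> real) \<Rightarrow> real^2 \<Rightarrow> real^2" where
  "grad v p = (THE D. GDERIV v p :> D)"

definition fem_form ::
  "(real^2) set \<Rightarrow> (real^2) set set \<Rightarrow> nat \<Rightarrow> (nat \<Rightarrow> real^2) \<Rightarrow> (real^2 \<Rightarrow> real^2^2) \<Rightarrow>
    nat \<Rightarrow> nat \<Rightarrow> real" where
  "fem_form \<Omega> T N x \<sigma> j k =
     (LINT p|lebesgue_on \<Omega>. inner (\<sigma> p *v grad (hat \<Omega> T N x j) p) (grad (hat \<Omega> T N x k) p))"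

definition fem_matrix ::
  "(real^2) set \<Rightarrow> (real^2) set set \<Rightarrow> nat \<Rightarrow> nat \<Rightarrow> (nat \<Rightarrow> real^2) \<Rightarrow> (real^2 \<Rightarrow> real^2^2) \<Rightarrow>
    real mat" where
  "fem_matrix \<Omega> T N B x \<sigma> = Matrix.mat N N (\<lambda>(j, k).
     if j < B then (if j = k then 1 else 0) else fem_form \<Omega> T N x \<sigma> j k)"

text \<open>
  The solution of \<open>L u = (f, 0)\<^sup>t\<close> for an \<open>N \<times> N\<close> matrix \<open>L\<close>. It is meaningful only for invertible
  \<open>L\<close>, and the same holds for the two Dirichlet-to-Neumann maps defined from it.
\<close>

definition dirichlet_solution :: "nat \<Rightarrow> nat \<Rightarrow> real mat \<Rightarrow> real Matrix.vec \<Rightarrow> real Matrix.vec" where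
  "dirichlet_solution N B L f = (THE u. u \<in> carrier_vec N \<and> L *\<^sub>v u = f @\<^sub>v 0\<^sub>v (N - B))"

definition fem_DN ::
  "(real^2) set \<Rightarrow> (real^2) set set \<Rightarrow> nat \<Rightarrow> nat \<Rightarrow> (nat \<Rightarrow> real^2) \<Rightarrow> (real^2 \<Rightarrow> real^2^2) \<Rightarrow>
    real Matrix.vec \<Rightarrow> real Matrix.vec" where
  "fem_DN \<Omega> T N B x \<sigma> f =
     (let u = dirichlet_solution N B (fem_matrix \<Omega> T N B x \<sigma>) f
      in Matrix.vec B (\<lambda>j. \<Sum>k<N. fem_form \<Omega> T N x \<sigma> j k * vec_index u k))"


section \<open>Resistor networks\<close>

text \<open>
  An edge set \<open>E\<close> consists of unordered pairs of points \<open>{x j, x k}\<close>.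
\<close>

definition conductance ::
  "(real^2) set set \<Rightarrow> (nat \<Rightarrow> real^2) \<Rightarrow> ((real^2) set \<Rightarrow> real) \<Rightarrow> nat \<Rightarrow> nat \<Rightarrow> real" where
  "conductance E x \<gamma> j k = (if {x j, x k} \<in> E then \<gamma> {x j, x k} else 0)"

definition network_matrix ::
  "(real^2) set set \<Rightarrow> nat \<Rightarrow> nat \<Rightarrow> (nat \<Rightarrow> real^2) \<Rightarrow> ((real^2) set \<Rightarrow> real) \<Rightarrow> real mat" where
  "network_matrix E N B x \<gamma> = Matrix.mat N N (\<lambda>(j, k).
     if j < B then (if j = k then 1 else 0)
     else if j = k then (\<Sum>i\<in>{..<N} - {j}. conductance E x \<gamma> j i)
     else - conductance E x \<gamma> j k)"

definition network_DN ::
  "(real^2) set set \<Rightarrow> nat \<Rightarrow> nat \<Rightarrow> (nat \<Rightarrow> real^2) \<Rightarrow> ((real^2) set \<Rightarrow> real) \<Rightarrow>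
    real Matrix.vec \<Rightarrow> real Matrix.vec" where
  "network_DN E N B x \<gamma> f =
     (let u = dirichlet_solution N B (network_matrix E N B x \<gamma>) f
      in Matrix.vec B (\<lambda>j. \<Sum>k\<in>{..<N} - {j}. conductance E x \<gamma> j k * (vec_index u j - vec_index u k)))"

end

theory Submission
  imports Defs "Jordan_Normal_Form.Determinant"
begin

text \<open>
  On each triangle the hat functions have constant gradients, so the form
  \<open>a j k = \<integral>\<sigma> \<nabla>v j \<bullet> \<nabla>v k\<close> is a finite sum over the triangles. It is symmetric, its rows sum to
  zero since the hat functions sum to one, and it vanishes for nonadjacent \<open>j \<noteq> k\<close>. Hence
  \<open>\<gamma> j k = - a j k\<close> is a resistor network with the same matrix and Dirichlet-to-Neumann map. A vector in
  the kernel of \<open>L\<close> has zero energy, so its nodal function is constant on each triangle, and it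
  vanishes because no nonzero level set can avoid the boundary vertices.
\<close>

section \<open>Affine functions on triangles\<close>

text \<open>Moving one point \<open>q\<close> to the origin turns the other points into linearly
  independent vectors, so the increments \<open>f p - f q\<close> extend to a linear
  functional.\<close>

lemma affine_interpolation:
  fixes C :: "'a::euclidean_space set" and f :: "'a \<Rightarrow> real"
  assumes "\<not> affine_dependent C"
  shows "\<exists>a b. \<forall>p\<in>C. inner a p + b = f p"
proof (cases "C = {}")
  case False
  then obtain q where q: "q \<in> C" by blast
  have "independent ((\<lambda>p. - q + p) ` (C - {q}))"
    using assms affine_dependent_iff_dependent2[OF q] by blast
  then obtain g :: "'a \<Rightarrow> real" where g: "linear g"
    "\<And>y. y \<in> (\<lambda>p. - q + p) ` (C - {q}) \<Longrightarrow> g y = f (q + y) - f q"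
    using linear_independent_extend[of "(\<lambda>p. - q + p) ` (C - {q})" "\<lambda>y. f (q + y) - f q"]
    by blast
  define a where "a = adjoint g 1"
  have ga: "g y = inner a y" for y
    using adjoint_works[OF g(1), of y 1] by (simp add: a_def inner_commute)
  have "inner a p + (f q - inner a q) = f p" if "p \<in> C" for p
  proof (cases "p = q")
    case False
    then have "g (- q + p) = f p - f q"
      using g(2)[of "- q + p"] that by auto
    then show ?thesis unfolding ga by (simp add: inner_diff_right algebra_simps)
  qed simp
  then show ?thesis by blast
qed simp

text \<open>The coincidence set of two affine functions has the form
  \<open>{p. inner c p = d}\<close>, hence is convex.\<close>

lemma affine_eq_on_convex_hull:
  fixes a a' :: "'a::euclidean_space"
  assumes "\<And>p. p \<in> C \<Longrightarrow> inner a p + b = inner a' p + b'" "p \<in> convex hull C"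
  shows "inner a p + b = inner a' p + b'"
proof -
  have eq: "{p. inner a p + b = inner a' p + b'} = {p. inner (a - a') p = b' - b}"
    by (auto simp: inner_diff_left algebra_simps)
  have "convex hull C \<subseteq> {p. inner a p + b = inner a' p + b'}"
    unfolding eq using assms(1)
    by (intro hull_minimal convex_hyperplane) (auto simp: inner_diff_left algebra_simps)
  with assms(2) show ?thesis by auto
qed

lemma GDERIV_unique:
  assumes "GDERIV f p :> D" "GDERIV f p :> D'"
  shows "D = D'"
proof -
  have "(\<lambda>h. inner h D) = (\<lambda>h. inner h D')"
    using assms unfolding gderiv_def by (rule has_derivative_unique)
  then have "inner h (D - D') = 0" for h
    by (auto simp: inner_diff_right dest: fun_cong[of _ _ h])
  then show ?thesis
    by (metis inner_eq_zero_iff right_minus_eq)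
qed

lemma GDERIV_affine:
  assumes "\<And>p. p \<in> t \<Longrightarrow> v p = inner a p + b" "p \<in> interior t"
  shows "GDERIV v p :> a"
proof -
  have "((\<lambda>p. inner a p + b) has_derivative (\<lambda>h. inner h a)) (at p)"
    by (auto intro!: derivative_eq_intros simp: inner_commute)
  then show ?thesis
    unfolding gderiv_def
    by (rule has_derivative_transform_within_open[OF _ open_interior assms(2)])
      (use assms(1) interior_subset[of t] in auto)
qed

lemma grad_affine:
  assumes "\<And>p. p \<in> t \<Longrightarrow> v p = inner a p + b" "p \<in> interior t"
  shows "grad v p = a"
  unfolding grad_def using GDERIV_affine[OF assms] GDERIV_unique by blast

text \<open>At an interior point both \<open>a\<close> and \<open>0\<close> are gradients of the
  same function.\<close>

lemma affine_constant_imp_zero: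
  fixes a :: "'a::euclidean_space"
  assumes "interior t \<noteq> {}" "\<And>p. p \<in> t \<Longrightarrow> inner a p + b = c"
  shows "a = 0"
proof -
  obtain p where p: "p \<in> interior t" using assms(1) by blast
  show ?thesis
    using GDERIV_affine[of t "\<lambda>p. inner a p + b" a b p]
      GDERIV_affine[of t "\<lambda>p. inner a p + b" 0 c p] assms(2) p GDERIV_unique by fastforce
qed

section \<open>Vertices and edges of a single triangle\<close>

abbreviation vertices_of :: "(real^2) set \<Rightarrow> (real^2) set" where
  "vertices_of t \<equiv> {p. p extreme_point_of t}"

lemma triangle_vertices:
  fixes t :: "(real^2) set"
  assumes "2 simplex t"
  shows "\<not> affine_dependent (vertices_of t)" "card (vertices_of t) = 3"
    and "convex hull (vertices_of t) = t" "interior t \<noteq> {}"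
proof -
  obtain C where C: "\<not> affine_dependent C" "int (card C) = 2 + 1" "t = convex hull C"
    using assms unfolding simplex_def by blast
  have v: "vertices_of t = C"
    using C extreme_point_of_convex_hull_affine_independent by auto
  show "\<not> affine_dependent (vertices_of t)" "card (vertices_of t) = 3"
    "convex hull (vertices_of t) = t"
    using C v by auto
  show "interior t \<noteq> {}"
    using C interior_convex_hull_eq_empty[of C] by auto
qed

text \<open>Every subset of an affinely independent set spans a face of the hull, so any two
  vertices of a triangle span an edge.\<close>

lemma triangle_edge:
  fixes t :: "(real^2) set"
  assumes "2 simplex t" "p extreme_point_of t" "q extreme_point_of t" "p \<noteq> q"
  shows "closed_segment p q edge_of t"
proof -
  have "convex hull {p, q} face_of convex hull (vertices_of t)"
    unfolding face_of_convex_hull_affine_independent[OF triangle_vertices(1)[OF assms(1)]]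
    using assms(2,3) by (intro exI[of _ "{p, q}"]) simp
  moreover have "aff_dim (closed_segment p q) = 1"
    using assms(4) by (simp add: segment_convex_hull aff_dim_convex_hull)
  ultimately show ?thesis
    using triangle_vertices(3)[OF assms(1)] by (simp add: edge_of_def segment_convex_hull)
qed

lemma edge_of_segment_endpoints:
  assumes "closed_segment p q edge_of t"
  shows "p extreme_point_of t" "q extreme_point_of t" "p \<noteq> q"
proof -
  have f: "closed_segment p q face_of t" and d: "aff_dim (closed_segment p q) = 1"
    using assms by (auto simp: edge_of_def)
  show "p extreme_point_of t" "q extreme_point_of t"
    using extreme_point_of_face[OF f] extreme_point_of_segment by blast+
  show "p \<noteq> q" using d by auto
qed

section \<open>Hat functions and the stiffness form\<close>

locale planar_triangulation =
  fixes \<Omega> :: "(real^2) set" and T :: "(real^2) set set"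
    and N B :: nat and x :: "nat \<Rightarrow> real^2"
  assumes open_domain: "open \<Omega>"
    and triangulation: "triangulation_of T \<Omega>"
    and labelling: "vertex_labelling \<Omega> T N B x"
begin

lemmas triangulation_conjuncts = triangulation[unfolded triangulation_of_def]

lemma finite_T: "finite T"
  using triangulation_conjuncts by (elim conjE)

lemma simplex_T: "t \<in> T \<Longrightarrow> 2 simplex t"
  using triangulation_conjuncts by (elim conjE bspec)

lemma Union_T: "\<Union>T = closure \<Omega>"
  using triangulation_conjuncts by (elim conjE)

lemma compact_T: "t \<in> T \<Longrightarrow> compact t"
  and convex_T: "t \<in> T \<Longrightarrow> convex t"
  using simplex_T compact_simplex convex_simplex by blast+

lemma closed_T: "t \<in> T \<Longrightarrow> closed t"
  using compact_T compact_imp_closed by blast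

lemma compact_closure_domain: "compact (closure \<Omega>)"
  using Union_T finite_T compact_T compact_Union by metis

text \<open>The empty set, a vertex and an edge are faces of dimension at most 1, while a triangle
  has dimension 2.\<close>

lemma intersection_proper_face:
  assumes "s \<in> T" "t \<in> T" "s \<noteq> t"
  shows "(s \<inter> t) face_of s" "(s \<inter> t) face_of t" "s \<inter> t \<noteq> s"
proof -
  have cases: "s \<inter> t = {} \<or> (\<exists>p. s \<inter> t = {p} \<and> p extreme_point_of s \<and> p extreme_point_of t) \<or>
      (s \<inter> t) edge_of s \<and> (s \<inter> t) edge_of t"
    using bspec[OF bspec[OF conjunct2[OF conjunct2[OF conjunct2[OF
      triangulation_conjuncts]]] assms(1)] assms(2)] assms(3) by (rule mp)
  then show "(s \<inter> t) face_of s" "(s \<inter> t) face_of t"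
    by (auto simp: face_of_singleton[symmetric] edge_of_def face_of_empty)
  from cases have "aff_dim (s \<inter> t) \<le> 1"
    by (auto simp: edge_of_def)
  moreover have "aff_dim s = 2" using simplex_T[OF assms(1)] aff_dim_simplex by blast
  ultimately show "s \<inter> t \<noteq> s" by auto
qed

lemma interiors_disjoint:
  assumes "s \<in> T" "t \<in> T" "s \<noteq> t"
  shows "interior s \<inter> t = {}"
  using face_of_disjoint_interior[OF intersection_proper_face(1,3)[OF assms]]
    interior_subset[of s] by blast

text \<open>By Minkowski the intersection is the hull of its extreme points, and extreme points of a
  common face are vertices of both triangles. This lets affine pieces that agree at vertices be
  glued.\<close>

lemma intersection_subset_hull_common_vertices:
  assumes "s \<in> T" "t \<in> T"
  shows "s \<inter> t \<subseteq> convex hull (vertices_of s \<inter> vertices_of t)"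
proof (cases "s = t")
  case True
  then show ?thesis using triangle_vertices(3)[OF simplex_T[OF assms(1)]] by simp
next
  case False
  note f = intersection_proper_face(1,2)[OF assms False]
  have "s \<inter> t = convex hull (vertices_of (s \<inter> t))"
    using compact_T convex_T assms by (intro Krein_Milman_Minkowski compact_Int convex_Int) auto
  moreover have "vertices_of (s \<inter> t) \<subseteq> vertices_of s \<inter> vertices_of t"
    using extreme_point_of_face[OF f(1)] extreme_point_of_face[OF f(2)] by blast
  ultimately show ?thesis using hull_mono by metis
qed

lemma vertex_index:
  assumes "t \<in> T" "p extreme_point_of t"
  obtains j where "j < N" "p = x j"
proof -
  have "p \<in> x ` {..<N}"
    using assms labelling unfolding vertex_labelling_def bij_betw_def tri_vertices_def by auto
  then show ?thesis using that by blast
qed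

lemma vertex_in_triangle:
  assumes "j < N"
  obtains t where "t \<in> T" "x j extreme_point_of t"
proof -
  have "x j \<in> tri_vertices T"
    using assms labelling unfolding vertex_labelling_def bij_betw_def by auto
  then show ?thesis using that unfolding tri_vertices_def by blast
qed

lemma x_inj: "inj_on x {..<N}"
  and B_le_N: "B \<le> N"
  using labelling unfolding vertex_labelling_def bij_betw_def by auto

lemma x_eq_iff: "j < N \<Longrightarrow> k < N \<Longrightarrow> x j = x k \<longleftrightarrow> j = k"
  using x_inj by (auto simp: inj_on_def)

lemma x_in_closure: "j < N \<Longrightarrow> x j \<in> closure \<Omega>"
  using vertex_in_triangle[of j] Union_T extreme_point_of_def by (metis UnionI)

section \<open>Piecewise affine interpolation of nodal values\<close>

definition nodal_function :: "(nat \<Rightarrow> real) \<Rightarrow> (real^2 \<Rightarrow> real) \<Rightarrow> bool" where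
  "nodal_function u v \<longleftrightarrow>
     continuous_on (closure \<Omega>) v \<and>
     (\<forall>t\<in>T. \<exists>a b. \<forall>p\<in>t. v p = inner a p + b) \<and>
     (\<forall>j<N. v (x j) = u j) \<and>
     (\<forall>p. p \<notin> closure \<Omega> \<longrightarrow> v p = 0)"

text \<open>Interpolate on each triangle separately. Two interpolants agree at common vertices,
  hence on the whole intersection, and pasting over finitely many closed sets keeps
  continuity.\<close>

lemma nodal_function_exists: "\<exists>v. nodal_function u v"
proof -
  define f where "f p = u (the_inv_into {..<N} x p)" for p
  have fx: "f (x j) = u j" if "j < N" for j
    using that x_inj by (simp add: f_def the_inv_into_f_f)
  have "\<forall>t\<in>T. \<exists>ab. \<forall>p\<in>vertices_of t. inner (fst ab) p + snd ab = f p"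
    using affine_interpolation triangle_vertices(1)[OF simplex_T] by fastforce
  then obtain ab where ab: "\<And>t p. t \<in> T \<Longrightarrow> p extreme_point_of t \<Longrightarrow> inner (fst (ab t)) p + snd (ab t) = f p"
    by (metis mem_Collect_eq)
  define l where "l t p = inner (fst (ab t)) p + snd (ab t)" for t and p :: "real^2"
  have agree: "l s p = l t p" if "s \<in> T" "t \<in> T" "p \<in> s" "p \<in> t" for s t p
  proof -
    have "p \<in> convex hull (vertices_of s \<inter> vertices_of t)"
      using intersection_subset_hull_common_vertices that by blast
    then show ?thesis unfolding l_def
      by (rule affine_eq_on_convex_hull[rotated]) (use ab that in auto)
  qed
  \<comment> \<open>By \<open>agree\<close> the value does not depend on the triangle
    chosen.\<close>
  define v where "v p = (if p \<in> closure \<Omega> then l (SOME t. t \<in> T \<and> p \<in> t) p else 0)" for p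
  have v: "v p = l t p" if "t \<in> T" "p \<in> t" for t p
  proof -
    have "(SOME t. t \<in> T \<and> p \<in> t) \<in> T \<and> p \<in> (SOME t. t \<in> T \<and> p \<in> t)"
      by (rule someI[of _ t]) (use that in auto)
    then have "l (SOME t. t \<in> T \<and> p \<in> t) p = l t p"
      using agree that by blast
    moreover have "p \<in> closure \<Omega>" using that Union_T by blast
    ultimately show ?thesis by (simp add: v_def)
  qed
  have "continuous_on (\<Union>t\<in>T. t) v"
  proof (rule continuous_on_closed_Union[OF finite_T])
    fix t assume t: "t \<in> T"
    then show "closed t" by (rule closed_T)
    have "continuous_on t (l t)" unfolding l_def by (intro continuous_intros)
    then show "continuous_on t v" using v[OF t] by (simp cong: continuous_on_cong)
  qed
  moreover have "v (x j) = u j" if j: "j < N" for j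
  proof -
    obtain t where t: "t \<in> T" "x j extreme_point_of t" using vertex_in_triangle[OF j] .
    then have "v (x j) = l t (x j)" using v by (simp add: extreme_point_of_def)
    also have "\<dots> = f (x j)" unfolding l_def using ab t by blast
    finally show ?thesis using fx[OF j] by simp
  qed
  moreover have "\<exists>a b. \<forall>p\<in>t. v p = inner a p + b" if "t \<in> T" for t
    using v[OF that] unfolding l_def by blast
  moreover have "v p = 0" if "p \<notin> closure \<Omega>" for p
    using that by (simp add: v_def)
  ultimately have "nodal_function u v"
    unfolding nodal_function_def using Union_T by simp
  then show ?thesis by blast
qed

lemma affine_eq_on_triangle:
  assumes "t \<in> T" "p \<in> t" "\<And>j. j < N \<Longrightarrow> x j \<in> vertices_of t \<Longrightarrow> inner a (x j) + b = inner a' (x j) + b'"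
  shows "inner a p + b = inner a' p + b'"
proof (rule affine_eq_on_convex_hull)
  show "p \<in> convex hull (vertices_of t)"
    using triangle_vertices(3)[OF simplex_T] assms(1,2) by simp
  show "inner a q + b = inner a' q + b'" if "q \<in> vertices_of t" for q
    using that vertex_index[OF assms(1), of q] assms(3) by auto
qed

lemma nodal_functionD:
  assumes "nodal_function u v"
  shows "continuous_on (closure \<Omega>) v"
    and "t \<in> T \<Longrightarrow> \<exists>a b. \<forall>p\<in>t. v p = inner a p + b"
    and "j < N \<Longrightarrow> v (x j) = u j"
    and "p \<notin> closure \<Omega> \<Longrightarrow> v p = 0"
  using assms by (simp_all add: nodal_function_def)

lemma nodal_function_unique:
  assumes v: "nodal_function u v" and w: "nodal_function u w"
  shows "v = w"
proof
  fix p
  show "v p = w p"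
  proof (cases "p \<in> closure \<Omega>")
    case True
    then obtain t where t: "t \<in> T" "p \<in> t" using Union_T by blast
    obtain a b where ab: "\<And>p. p \<in> t \<Longrightarrow> v p = inner a p + b"
      using nodal_functionD(2)[OF v t(1)] by blast
    obtain a' b' where ab': "\<And>p. p \<in> t \<Longrightarrow> w p = inner a' p + b'"
      using nodal_functionD(2)[OF w t(1)] by blast
    have "inner a (x j) + b = inner a' (x j) + b'" if "j < N" "x j \<in> vertices_of t" for j
    proof -
      have "v (x j) = w (x j)" using nodal_functionD(3)[OF v] nodal_functionD(3)[OF w] that by simp
      then show ?thesis using ab ab' that by (simp add: extreme_point_of_def)
    qed
    then have "inner a p + b = inner a' p + b'" using affine_eq_on_triangle[OF t] by blast
    then show ?thesis using ab ab' t by simp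
  next
    case False
    then show ?thesis using nodal_functionD(4)[OF v] nodal_functionD(4)[OF w] by simp
  qed
qed

abbreviation h :: "nat \<Rightarrow> real^2 \<Rightarrow> real" where
  "h \<equiv> hat \<Omega> T N x"

text \<open>Existence and uniqueness give the definite description in \<open>hat\<close> a meaning;
  \<open>nodal_function\<close> repeats its conditions verbatim, so unfolding closes the
  goal.\<close>

lemma nodal_function_hat: "nodal_function (\<lambda>j. if j = k then 1 else 0) (h k)"
proof -
  have "\<exists>!v. nodal_function (\<lambda>j. if j = k then 1 else 0) v"
    using nodal_function_exists nodal_function_unique by blast
  from theI'[OF this] show ?thesis
    unfolding hat_def nodal_function_def .
qed

lemma hat_vertex: "j < N \<Longrightarrow> h k (x j) = (if j = k then 1 else 0)"
  and continuous_on_hat: "continuous_on (closure \<Omega>) (h k)"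
  using nodal_functionD[OF nodal_function_hat] by simp_all

section \<open>Constant gradients of the hat functions\<close>

definition slope :: "nat \<Rightarrow> (real^2) set \<Rightarrow> real^2" where
  "slope k t = (SOME a. \<exists>b. \<forall>p\<in>t. h k p = inner a p + b)"

definition offset :: "nat \<Rightarrow> (real^2) set \<Rightarrow> real" where
  "offset k t = (SOME b. \<forall>p\<in>t. h k p = inner (slope k t) p + b)"

lemma hat_on_triangle:
  assumes "t \<in> T" "p \<in> t"
  shows "h k p = inner (slope k t) p + offset k t"
proof -
  have "\<exists>a b. \<forall>p\<in>t. h k p = inner a p + b"
    using nodal_functionD(2)[OF nodal_function_hat assms(1)] .
  then have "\<exists>b. \<forall>p\<in>t. h k p = inner (slope k t) p + b"
    unfolding slope_def by (rule someI_ex)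
  then have "\<forall>p\<in>t. h k p = inner (slope k t) p + offset k t"
    unfolding offset_def by (rule someI_ex)
  then show ?thesis using assms(2) by blast
qed

lemma grad_hat: "t \<in> T \<Longrightarrow> p \<in> interior t \<Longrightarrow> grad (h k) p = slope k t"
  by (rule grad_affine[OF hat_on_triangle])

lemma hat_sum_on_triangle:
  assumes "t \<in> T" "p \<in> t"
  shows "(\<Sum>k<N. u k * h k p) = inner (\<Sum>k<N. u k *\<^sub>R slope k t) p + (\<Sum>k<N. u k * offset k t)"
  using hat_on_triangle[OF assms]
  by (simp add: inner_sum_left sum.distrib[symmetric] algebra_simps)

lemma hat_sum_vertex: "j < N \<Longrightarrow> (\<Sum>k<N. u k * h k (x j)) = u j"
  by (simp add: hat_vertex sum.delta' if_distrib cong: if_cong)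

text \<open>The hat functions sum to one at the vertices of \<open>t\<close>, hence on
  \<open>t\<close>, and the gradient of a constant vanishes.\<close>

lemma slope_sum_eq_zero:
  assumes "t \<in> T"
  shows "(\<Sum>k<N. slope k t) = 0"
proof (rule affine_constant_imp_zero)
  show "interior t \<noteq> {}" using triangle_vertices(4) simplex_T assms by blast
  show "inner (\<Sum>k<N. slope k t) p + (\<Sum>k<N. offset k t) = 1" if p: "p \<in> t" for p
  proof -
    \<comment> \<open>The constant 1 is written as an affine function, to be compared at the
      vertices only.\<close>
    have "inner (\<Sum>k<N. slope k t) p + (\<Sum>k<N. offset k t) = inner 0 p + 1"
    proof (rule affine_eq_on_triangle[OF assms p])
      fix j assume j: "j < N" "x j \<in> vertices_of t"
      then have "x j \<in> t" by (simp add: extreme_point_of_def)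
      then show "inner (\<Sum>k<N. slope k t) (x j) + (\<Sum>k<N. offset k t) = inner 0 (x j) + 1"
        using hat_sum_on_triangle[OF assms, of "x j" "\<lambda>_. 1"] hat_sum_vertex[OF j(1), of "\<lambda>_. 1"]
        by simp
    qed
    then show ?thesis by simp
  qed
qed

text \<open>Such a hat function vanishes at all vertices of \<open>t\<close>, hence on
  \<open>t\<close>.\<close>

lemma slope_eq_zero:
  assumes "t \<in> T" "k < N" "x k \<notin> vertices_of t"
  shows "slope k t = 0"
proof (rule affine_constant_imp_zero)
  show "interior t \<noteq> {}" using triangle_vertices(4) simplex_T assms by blast
  show "inner (slope k t) p + offset k t = 0" if p: "p \<in> t" for p
  proof -
    have "inner (slope k t) p + offset k t = inner 0 p + 0"
    proof (rule affine_eq_on_triangle[OF assms(1) p])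
      fix j assume j: "j < N" "x j \<in> vertices_of t"
      then have "j \<noteq> k" "x j \<in> t" using assms(3) by (auto simp: extreme_point_of_def)
      then show "inner (slope k t) (x j) + offset k t = inner 0 (x j) + 0"
        using hat_on_triangle[OF assms(1), of "x j" k] hat_vertex[OF j(1), of k] by simp
    qed
    then show ?thesis by simp
  qed
qed

text \<open>
  Discrete unique continuation. An extreme point of the convex hull of a nonzero level set is a
  vertex; as an interior one it would have a neighbourhood in the level set, which is a union of
  triangles.
\<close>

lemma nodal_values_zero:
  assumes boundary: "\<And>j. j < B \<Longrightarrow> u j = 0"
    and flat: "\<And>t. t \<in> T \<Longrightarrow> (\<Sum>k<N. u k *\<^sub>R slope k t) = 0"
    and "k < N"
  shows "u k = 0"
proof (rule ccontr)
  assume nz: "u k \<noteq> 0"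
  define v where "v p = (\<Sum>k<N. u k * h k p)" for p
  define S where "S = {p \<in> closure \<Omega>. v p = u k}"
  \<comment> \<open>As \<open>v\<close> is constant on each triangle, a triangle lies in the level
    set \<open>S\<close> or misses it. So \<open>R\<close> is a closed set disjoint from
    \<open>S\<close> that covers the rest of \<open>closure \<Omega>\<close>.\<close>
  define R where "R = \<Union>{t \<in> T. \<not> t \<subseteq> S}"
  have const: "v p = v q" if "t \<in> T" "p \<in> t" "q \<in> t" for t p q
    using hat_sum_on_triangle[of t _ u] flat that unfolding v_def by simp
  have sub: "t \<subseteq> S" if "t \<in> T" "p \<in> t" "p \<in> S" for t p
  proof
    fix q assume "q \<in> t"
    then have "q \<in> closure \<Omega>" "v q = v p" using const[of t q p] that Union_T by blast+
    then show "q \<in> S" using \<open>p \<in> S\<close> by (simp add: S_def)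
  qed
  have R: "closed R" "R \<inter> S = {}" "closure \<Omega> - R \<subseteq> S"
  proof -
    show "closed R" unfolding R_def using finite_T closed_T by (intro closed_Union) auto
    show "R \<inter> S = {}" using sub unfolding R_def by blast
    show "closure \<Omega> - R \<subseteq> S" unfolding Union_T[symmetric] R_def by blast
  qed
  have "continuous_on (closure \<Omega>) v"
    unfolding v_def by (intro continuous_intros continuous_on_hat)
  then have "closed S"
    unfolding S_def by (intro continuous_closed_preimage_constant closed_closure)
  then have "compact (closure \<Omega> \<inter> S)"
    using compact_closure_domain by (rule compact_Int_closed[rotated])
  moreover have "closure \<Omega> \<inter> S = S" unfolding S_def by blast
  ultimately have "compact S" by simp
  moreover have "x k \<in> S"
    using hat_sum_vertex[OF assms(3), of u] x_in_closure[OF assms(3)] by (simp add: S_def v_def)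
  ultimately obtain e where e: "e extreme_point_of (convex hull S)"
    using extreme_point_exists_convex[of "convex hull S"] by (auto simp: compact_convex_hull)
  then have eS: "e \<in> S" by (rule extreme_point_of_convex_hull)
  then obtain t where t: "t \<in> T" "e \<in> t" using Union_T unfolding S_def by blast
  \<comment> \<open>An extreme point of a set stays extreme in any subset containing it, so
    \<open>e\<close> is a vertex of \<open>t\<close>.\<close>
  have "t \<subseteq> convex hull S" by (rule order_trans[OF sub[OF t eS] hull_subset])
  then have "e extreme_point_of t"
    using e t(2) unfolding extreme_point_of_def by blast
  then obtain i where i: "i < N" "e = x i" using vertex_index t(1) by blast
  have "u i = u k" using eS i hat_sum_vertex[OF i(1), of u] by (simp add: S_def v_def)
  then have "\<not> i < B" using boundary nz by auto
  then have "x i \<notin> x ` {..<B}"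
    using i(1) B_le_N x_eq_iff by auto
  moreover have "x i \<in> tri_vertices T"
    using \<open>e extreme_point_of t\<close> t(1) i by (auto simp: tri_vertices_def)
  ultimately have "e \<notin> frontier \<Omega>"
    using labelling i unfolding vertex_labelling_def by blast
  \<comment> \<open>The open set \<open>\<Omega> - R\<close> lies in \<open>S\<close>, which makes
    \<open>e\<close> an interior point of the hull, contradicting extremality.\<close>
  then have "e \<in> \<Omega> - R"
    using eS R open_domain interior_open unfolding frontier_def S_def by blast
  moreover have "open (\<Omega> - R)" using open_domain R(1) by blast
  moreover have "\<Omega> - R \<subseteq> convex hull S"
  proof (rule order_trans[OF _ hull_subset])
    show "\<Omega> - R \<subseteq> S" using R(3) closure_subset[of \<Omega>] by blast
  qed
  ultimately have "e \<in> interior (convex hull S)"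
    using interiorI by metis
  then show False using e extreme_point_not_in_interior by blast
qed

text \<open>
  Cutting with \<open>\<Omega>\<close> spares the proof that the interiors of the triangles lie in \<open>\<Omega>\<close>: positivity of the
  weights needs only that \<open>\<Omega>\<close> is open and dense in the union of the triangles.
\<close>

definition weight :: "(real^2) set \<Rightarrow> real" where
  "weight t = measure lebesgue (interior t \<inter> \<Omega>)"

lemma lmeasurable_piece: "interior t \<inter> \<Omega> \<in> lmeasurable"
proof -
  have "bounded \<Omega>"
    using compact_closure_domain by (meson bounded_subset closure_subset compact_imp_bounded)
  then show ?thesis
    using open_domain by (intro lmeasurable_open) (auto intro: bounded_subset)
qed

text \<open>The open set \<open>interior t\<close> is nonempty and lies in
  \<open>closure \<Omega>\<close>; an open set meeting a closure meets the set itself.\<close>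

lemma not_negligible_piece:
  assumes "t \<in> T"
  shows "\<not> negligible (interior t \<inter> \<Omega>)"
proof (rule open_not_negligible)
  show "open (interior t \<inter> \<Omega>)" using open_domain by blast
  have "interior t \<inter> closure \<Omega> \<noteq> {}"
    using triangle_vertices(4)[OF simplex_T[OF assms]] Union_T assms interior_subset by blast
  then show "interior t \<inter> \<Omega> \<noteq> {}"
    using open_Int_closure_eq_empty[OF open_interior] by blast
qed

lemma weight_pos: "t \<in> T \<Longrightarrow> weight t > 0"
  using not_negligible_piece[of t] lmeasurable_piece[of t]
  by (simp add: weight_def negligible_iff_measure zero_less_measure_iff)

end

lemma sets_lebesgue_interior: "interior S \<in> sets lebesgue"
  by (simp add: borel_open sets_completionI_sets)

section \<open>The stiffness form of a piecewise constant conductivity\<close>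

locale planar_conductivity = planar_triangulation +
  fixes \<sigma> :: "real^2 \<Rightarrow> real^2^2"
  assumes conductivity: "\<sigma> \<in> PC_plus \<Omega> T"
begin

definition value_on :: "(real^2) set \<Rightarrow> real^2^2" where
  "value_on t = (SOME A. transpose A = A \<and> positive_definite A \<and>
     (AE p in lebesgue. p \<in> interior t \<longrightarrow> \<sigma> p = A))"

text \<open>Symmetry comes with the constant matrix \<open>A\<close>, positivity only with the
  values of \<open>\<sigma>\<close> almost everywhere. It passes to \<open>A\<close> because
  \<open>interior t\<close> is not a null set, so that some point satisfies both almost-everywhere
  statements.\<close>

lemma
  assumes "t \<in> T"
  shows transpose_value_on: "transpose (value_on t) = value_on t"
    and positive_definite_value_on: "positive_definite (value_on t)"
    and AE_value_on: "AE p in lebesgue. p \<in> interior t \<longrightarrow> \<sigma> p = value_on t"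
proof -
  obtain A where A: "transpose A = A" "AE p in lebesgue_on (interior t). \<sigma> p = A"
    using conductivity assms unfolding PC_plus_def PC_def by blast
  have pd: "AE p in lebesgue_on (interior t). positive_definite (\<sigma> p)"
    using conductivity assms unfolding PC_plus_def by blast
  have A': "AE p in lebesgue. p \<in> interior t \<longrightarrow> \<sigma> p = A"
    using A(2) sets_lebesgue_interior by (subst (asm) AE_restrict_space_iff) auto
  have pd': "AE p in lebesgue. p \<in> interior t \<longrightarrow> positive_definite (\<sigma> p)"
    using pd sets_lebesgue_interior by (subst (asm) AE_restrict_space_iff) auto
  have "positive_definite A"
  proof (rule ccontr)
    assume "\<not> positive_definite A"
    with A' pd' have "AE p in lebesgue. p \<notin> interior t"
      by (auto elim: AE_mp)
    then have "negligible (interior t)"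
      using sets_lebesgue_interior[of t]
      by (simp add: negligible_iff_null_sets AE_iff_null_sets)
    then show False
      using open_not_negligible[OF open_interior] triangle_vertices(4)[OF simplex_T[OF assms]]
      by blast
  qed
  then have "\<exists>A. transpose A = A \<and> positive_definite A \<and>
     (AE p in lebesgue. p \<in> interior t \<longrightarrow> \<sigma> p = A)"
    using A(1) A' by blast
  from someI_ex[OF this] show "transpose (value_on t) = value_on t"
    "positive_definite (value_on t)" "AE p in lebesgue. p \<in> interior t \<longrightarrow> \<sigma> p = value_on t"
    unfolding value_on_def by blast+
qed

abbreviation form :: "nat \<Rightarrow> nat \<Rightarrow> real" where
  "form \<equiv> fem_form \<Omega> T N x \<sigma>"

text \<open>Off the null set of triangle frontiers, each point of \<open>\<Omega>\<close> lies in
  the interior of exactly one triangle, where the integrand is almost everywhere constant. It thus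
  agrees almost everywhere with the simple function \<open>g\<close>.\<close>

lemma form_eq_sum:
  "form j k = (\<Sum>t\<in>T. weight t * inner (value_on t *v slope j t) (slope k t))"
proof -
  define c where "c t = inner (value_on t *v slope j t) (slope k t)" for t
  define f where "f p = inner (\<sigma> p *v grad (h j) p) (grad (h k) p)" for p
  define g where "g p = (\<Sum>t\<in>T. indicator (interior t \<inter> \<Omega>) p *\<^sub>R c t)" for p
  have "AE p in lebesgue. \<forall>t\<in>T. p \<in> interior t \<longrightarrow> \<sigma> p = value_on t"
    using AE_value_on finite_T by (intro AE_finite_allI) auto
  moreover have "AE p in lebesgue. \<forall>t\<in>T. p \<notin> frontier t"
  proof (intro AE_finite_allI finite_T)
    fix t assume "t \<in> T"
    then have "frontier t \<in> null_sets lebesgue"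
      using negligible_convex_frontier convex_T negligible_iff_null_sets by blast
    then show "AE p in lebesgue. p \<notin> frontier t" by (rule AE_not_in)
  qed
  ultimately have ae: "AE p in lebesgue. g p = indicator \<Omega> p *\<^sub>R f p"
  proof eventually_elim
    case (elim p)
    show ?case
    proof (cases "p \<in> \<Omega>")
      case True
      then obtain t where t: "t \<in> T" "p \<in> t" using Union_T closure_subset by blast
      then have p: "p \<in> interior t"
        using elim(2) closed_T unfolding frontier_def by auto
      have "g p = (\<Sum>s\<in>T. if s = t then c t else 0)"
        unfolding g_def
      proof (rule sum.cong[OF refl])
        fix s assume "s \<in> T"
        then show "indicator (interior s \<inter> \<Omega>) p *\<^sub>R c s = (if s = t then c t else 0)"
          using interiors_disjoint[of s t] t p True by (auto simp: indicator_def)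
      qed
      also have "\<dots> = c t" using t finite_T by simp
      also have "\<dots> = f p"
        using elim(1) t p by (simp add: f_def c_def grad_hat)
      finally show ?thesis using True by simp
    next
      case False
      then show ?thesis by (simp add: g_def)
    qed
  qed
  have int: "integrable lebesgue (\<lambda>p. indicator (interior t \<inter> \<Omega>) p *\<^sub>R c t)" for t
    using lmeasurable_piece[of t] by (intro integrable_scaleR_left) (auto simp: fmeasurable_def)
  have gm: "g \<in> borel_measurable lebesgue"
    unfolding g_def using int by (intro borel_measurable_integrable Bochner_Integration.integrable_sum) auto
  have "form j k = integral\<^sup>L lebesgue (\<lambda>p. indicator \<Omega> p *\<^sub>R f p)"
    unfolding fem_form_def f_def using open_domain
    by (intro integral_restrict_space) (simp add: borel_open sets_completionI_sets)
  \<comment> \<open>Since \<open>grad\<close> is unspecified on the sides, measurability of the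
    integrand is transferred from \<open>g\<close> through almost-everywhere equality.\<close>
  also have "\<dots> = integral\<^sup>L lebesgue g"
    using gm borel_measurable_AE[OF gm ae] ae by (intro integral_cong_AE) auto
  also have "\<dots> = (\<Sum>t\<in>T. weight t * c t)"
    unfolding g_def using int lmeasurable_piece
    by (subst Bochner_Integration.integral_sum) (auto simp: weight_def fmeasurable_def)
  finally show ?thesis unfolding c_def .
qed

lemma form_sym: "form j k = form k j"
proof -
  have "inner (value_on t *v v) w = inner (value_on t *v w) v" if "t \<in> T" for t v w
  proof -
    have "inner (value_on t *v v) w = inner (v v* value_on t) w"
      using transpose_matrix_vector[of "value_on t" v] transpose_value_on[OF that] by simp
    also have "\<dots> = inner v (value_on t *v w)" by (rule dot_lmul_matrix)
    finally show ?thesis by (simp add: inner_commute)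
  qed
  then show ?thesis unfolding form_eq_sum by simp
qed

lemma form_row_sum: "(\<Sum>k<N. form j k) = 0"
proof -
  have "(\<Sum>k<N. form j k) = (\<Sum>t\<in>T. weight t * inner (value_on t *v slope j t) (\<Sum>k<N. slope k t))"
    unfolding form_eq_sum by (subst sum.swap) (simp add: inner_sum_right sum_distrib_left)
  then show ?thesis using slope_sum_eq_zero by simp
qed

text \<open>A triangle on which both slopes are nonzero has both points as vertices, and then they
  span one of its edges.\<close>

lemma form_nonadjacent:
  assumes "j < N" "k < N" "j \<noteq> k" "{x j, x k} \<notin> tri_edges T"
  shows "form j k = 0"
proof -
  have "slope j t = 0 \<or> slope k t = 0" if t: "t \<in> T" for t
  proof (rule ccontr)
    assume "\<not> ?thesis"
    then have "x j extreme_point_of t" "x k extreme_point_of t"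
      using slope_eq_zero[OF t] assms(1,2) by auto
    then have "closed_segment (x j) (x k) edge_of t"
      using triangle_edge[OF simplex_T[OF t]] assms x_eq_iff by blast
    then show False using assms(4) t unfolding tri_edges_def by blast
  qed
  then have "inner (value_on t *v slope j t) (slope k t) = 0" if "t \<in> T" for t
    using that by fastforce
  then show ?thesis unfolding form_eq_sum by simp
qed

text \<open>This is the energy of \<open>\<Sum>k<N. u k * h k\<close>, whose gradient on
  \<open>t\<close> is the same combination of slopes.\<close>

lemma form_quadratic:
  "(\<Sum>j<N. u j * (\<Sum>k<N. form j k * u k)) =
    (\<Sum>t\<in>T. weight t * inner (value_on t *v (\<Sum>k<N. u k *\<^sub>R slope k t)) (\<Sum>k<N. u k *\<^sub>R slope k t))"
proof -
  have "(\<Sum>t\<in>T. weight t * inner (value_on t *v (\<Sum>k<N. u k *\<^sub>R slope k t)) (\<Sum>k<N. u k *\<^sub>R slope k t))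
    = (\<Sum>t\<in>T. \<Sum>j<N. \<Sum>k<N. u j * (u k * (weight t * inner (value_on t *v slope k t) (slope j t))))"
    by (simp add: linear_sum[OF matrix_vector_mul_linear] matrix_vector_mult_scaleR inner_sum_left
        inner_sum_right sum_distrib_left mult_ac)
  also have "\<dots> = (\<Sum>j<N. \<Sum>k<N. \<Sum>t\<in>T. u j * (u k * (weight t * inner (value_on t *v slope k t) (slope j t))))"
    by (subst sum.swap, intro sum.cong refl, subst sum.swap) simp
  also have "\<dots> = (\<Sum>j<N. u j * (\<Sum>k<N. form k j * u k))"
    unfolding form_eq_sum by (simp add: sum_distrib_left sum_distrib_right mult_ac)
  also have "\<dots> = (\<Sum>j<N. u j * (\<Sum>k<N. form j k * u k))"
    by (simp only: form_sym)
  finally show ?thesis by simp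
qed

text \<open>Testing the interior equations with \<open>u\<close> itself gives zero energy, the
  boundary terms vanishing with \<open>u\<close>. All summands are nonnegative, so every gradient is
  zero and \<open>nodal_values_zero\<close> applies.\<close>

lemma form_dirichlet_definite:
  assumes boundary: "\<And>j. j < B \<Longrightarrow> u j = 0"
    and harmonic: "\<And>j. B \<le> j \<Longrightarrow> j < N \<Longrightarrow> (\<Sum>k<N. form j k * u k) = 0"
    and "k < N"
  shows "u k = 0"
proof (rule nodal_values_zero[OF boundary _ assms(3)])
  define s where "s t = (\<Sum>k<N. u k *\<^sub>R slope k t)" for t
  have nonneg: "weight t * inner (value_on t *v s t) (s t) \<ge> 0" if "t \<in> T" for t
    using weight_pos[OF that] positive_definite_value_on[OF that]
    by (cases "s t = 0") (auto simp: positive_definite_def inner_commute less_imp_le)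
  have "(\<Sum>j<N. u j * (\<Sum>k<N. form j k * u k)) = 0"
    using boundary harmonic by (intro sum.neutral) (metis lessThan_iff mult_eq_0_iff not_le)
  then have "(\<Sum>t\<in>T. weight t * inner (value_on t *v s t) (s t)) = 0"
    unfolding form_quadratic s_def .
  then have zero: "\<forall>t\<in>T. weight t * inner (value_on t *v s t) (s t) = 0"
    using nonneg by (subst (asm) sum_nonneg_eq_0_iff[OF finite_T]) auto
  show "(\<Sum>k<N. u k *\<^sub>R slope k t) = 0" if t: "t \<in> T" for t
  proof (rule ccontr)
    assume "\<not> ?thesis"
    then have "inner (value_on t *v s t) (s t) > 0"
      using positive_definite_value_on[OF t] by (simp add: positive_definite_def inner_commute s_def)
    then show False using zero t weight_pos[OF t] by fastforce
  qed
qed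

end

section \<open>Dirichlet-to-Neumann matrices as resistor networks\<close>

lemma invertible_mat_if_trivial_kernel:
  fixes A :: "real mat"
  assumes A: "A \<in> carrier_mat n n"
    and ker: "\<And>v. v \<in> carrier_vec n \<Longrightarrow> A *\<^sub>v v = 0\<^sub>v n \<Longrightarrow> v = 0\<^sub>v n"
  shows "invertible_mat A"
proof -
  have d: "Determinant.det A \<noteq> 0"
    using det_0_iff_vec_prod_zero[OF A] ker by blast
  define C where "C = (1 / Determinant.det A) \<cdot>\<^sub>m adj_mat A"
  have "(1 / Determinant.det A) \<cdot>\<^sub>m (Determinant.det A \<cdot>\<^sub>m 1\<^sub>m n) = 1\<^sub>m n"
    using d by (intro eq_matI) auto
  then have "A * C = 1\<^sub>m n" "C * A = 1\<^sub>m n" "C \<in> carrier_mat n n"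
    using adj_mat[OF A] A
    by (auto simp: C_def mult_smult_distrib[of _ n n _ n] mult_smult_assoc_mat[of _ n n _ n])
  then show ?thesis
    using A unfolding invertible_mat_def inverts_mat_def square_mat.simps by (intro conjI exI[of _ C]) auto
qed

lemma dirichlet_solution_carrier_eq:
  assumes A: "A \<in> carrier_mat N N" and inv: "invertible_mat A" and f: "f \<in> carrier_vec B"
    and BN: "B \<le> N"
  shows "dirichlet_solution N B A f \<in> carrier_vec N"
    and "A *\<^sub>v dirichlet_solution N B A f = f @\<^sub>v 0\<^sub>v (N - B)"
proof -
  obtain C where C: "A * C = 1\<^sub>m N" "C * A = 1\<^sub>m (dim_row C)"
    using inv A unfolding invertible_mat_def inverts_mat_def by auto
  \<comment> \<open>\<open>invertible_mat\<close> says nothing about the size of the inverse; it is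
    read off by comparing the columns in the two identities.\<close>
  have Cc: "C \<in> carrier_mat N N"
  proof
    show "dim_col C = N" using arg_cong[OF C(1), of dim_col] by simp
    show "dim_row C = N" using arg_cong[OF C(2), of dim_col] A by simp
  qed
  define r where "r = f @\<^sub>v 0\<^sub>v (N - B)"
  have r: "r \<in> carrier_vec N" using f BN by (intro carrier_vecI) (simp add: r_def)
  have "\<exists>!u. u \<in> carrier_vec N \<and> A *\<^sub>v u = r"
  proof (rule ex1I[of _ "C *\<^sub>v r"])
    have "A *\<^sub>v (C *\<^sub>v r) = (A * C) *\<^sub>v r" using A Cc r by simp
    then show "C *\<^sub>v r \<in> carrier_vec N \<and> A *\<^sub>v (C *\<^sub>v r) = r" using C Cc r by simp
    fix u assume u: "u \<in> carrier_vec N \<and> A *\<^sub>v u = r"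
    have "C *\<^sub>v (A *\<^sub>v u) = (C * A) *\<^sub>v u" using A Cc u by simp
    then show "u = C *\<^sub>v r" using u C Cc by simp
  qed
  from theI'[OF this] show "dirichlet_solution N B A f \<in> carrier_vec N"
    "A *\<^sub>v dirichlet_solution N B A f = f @\<^sub>v 0\<^sub>v (N - B)"
    unfolding dirichlet_solution_def r_def by auto
qed

text \<open>Collects the properties of the stiffness form that yield a network, free of geometry.
  The assumption \<open>definite\<close> says that the matrix \<open>L\<close> below has trivial
  kernel.\<close>

locale stiffness_network =
  fixes a :: "nat \<Rightarrow> nat \<Rightarrow> real" and E :: "(real^2) set set"
    and N B :: nat and x :: "nat \<Rightarrow> real^2"
  assumes B_le: "B \<le> N"
    and inj_x: "inj_on x {..<N}"
    and edges: "e \<in> E \<Longrightarrow> \<exists>j<N. \<exists>k<N. j \<noteq> k \<and> e = {x j, x k}"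
    and sym: "a j k = a k j"
    and row_sum: "(\<Sum>k<N. a j k) = 0"
    and nonadjacent: "j < N \<Longrightarrow> k < N \<Longrightarrow> j \<noteq> k \<Longrightarrow> {x j, x k} \<notin> E \<Longrightarrow> a j k = 0"
    and definite: "(\<And>j. j < B \<Longrightarrow> u j = 0) \<Longrightarrow>
      (\<And>j. B \<le> j \<Longrightarrow> j < N \<Longrightarrow> (\<Sum>k<N. a j k * u k) = 0) \<Longrightarrow> k < N \<Longrightarrow> u k = 0"
begin

definition L :: "real mat" where
  "L = Matrix.mat N N (\<lambda>(j, k). if j < B then (if j = k then 1 else 0) else a j k)"

definition DN :: "real Matrix.vec \<Rightarrow> real Matrix.vec" where
  "DN f = Matrix.vec B (\<lambda>j. \<Sum>k<N. a j k * vec_index (dirichlet_solution N B L f) k)"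

lemma L_carrier: "L \<in> carrier_mat N N"
  by (simp add: L_def)

lemma L_mult_vec:
  assumes "u \<in> carrier_vec N" "j < N"
  shows "vec_index (L *\<^sub>v u) j = (if j < B then vec_index u j else (\<Sum>k<N. a j k * vec_index u k))"
proof -
  have "vec_index (L *\<^sub>v u) j = (\<Sum>k<N. L $$ (j, k) * vec_index u k)"
    using assms L_carrier by (simp add: scalar_prod_def atLeast0LessThan)
  also have "\<dots> = (\<Sum>k<N. (if j < B then (if j = k then 1 else 0) else a j k) * vec_index u k)"
    using assms by (intro sum.cong) (auto simp: L_def)
  also have "\<dots> = (if j < B then vec_index u j else (\<Sum>k<N. a j k * vec_index u k))"
    using assms by (auto simp: if_distrib[of "\<lambda>c. c * _"] sum.delta cong: if_cong)
  finally show ?thesis .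
qed

lemma invertible_L: "invertible_mat L"
proof (rule invertible_mat_if_trivial_kernel[OF L_carrier])
  fix u assume u: "u \<in> carrier_vec N" "L *\<^sub>v u = 0\<^sub>v N"
  have e: "(if j < B then vec_index u j else (\<Sum>k<N. a j k * vec_index u k)) = 0" if "j < N" for j
    using L_mult_vec[OF u(1) that] u(2) that by simp
  have "vec_index u k = 0" if "k < N" for k
  proof (rule definite[OF _ _ that])
    show "vec_index u j = 0" if "j < B" for j using e[of j] that B_le by simp
    show "(\<Sum>k<N. a j k * vec_index u k) = 0" if "B \<le> j" "j < N" for j using e[of j] that by simp
  qed
  then show "u = 0\<^sub>v N" using u(1) by (intro eq_vecI) auto
qed

lemma dirichlet_solution_boundary:
  assumes "f \<in> carrier_vec B" "i < B"
  shows "vec_index (dirichlet_solution N B L f) i = vec_index f i"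
proof -
  note s = dirichlet_solution_carrier_eq[OF L_carrier invertible_L assms(1) B_le]
  have "vec_index (L *\<^sub>v dirichlet_solution N B L f) i = vec_index f i"
    using assms carrier_vecD[OF assms(1)] unfolding s(2) by simp
  then show ?thesis
    using L_mult_vec[OF s(1), of i] assms(2) B_le by simp
qed

section \<open>The network realising the matrix\<close>

definition \<gamma>0 :: "(real^2) set \<Rightarrow> real" where
  "\<gamma>0 = restrict (\<lambda>e. THE c. \<exists>j<N. \<exists>k<N. j \<noteq> k \<and> e = {x j, x k} \<and> c = - a j k) E"

lemma conductance_\<gamma>0:
  assumes "j < N" "k < N" "j \<noteq> k"
  shows "conductance E x \<gamma>0 j k = - a j k"
proof (cases "{x j, x k} \<in> E")
  case True
  have "(THE c. \<exists>j'<N. \<exists>k'<N. j' \<noteq> k' \<and> {x j, x k} = {x j', x k'} \<and> c = - a j' k') = - a j k"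
  proof (rule the_equality)
    show "\<exists>j'<N. \<exists>k'<N. j' \<noteq> k' \<and> {x j, x k} = {x j', x k'} \<and> - a j k = - a j' k'"
      using assms by blast
    fix c assume "\<exists>j'<N. \<exists>k'<N. j' \<noteq> k' \<and> {x j, x k} = {x j', x k'} \<and> c = - a j' k'"
    then obtain j' k' where c: "j' < N" "k' < N" "{x j, x k} = {x j', x k'}" "c = - a j' k'"
      by blast
    \<comment> \<open>An edge determines its labels up to a swap, under which \<open>a\<close> is
      invariant; so the \<open>THE\<close> in \<open>\<gamma>0\<close> is well defined.\<close>
    then have "j = j' \<and> k = k' \<or> j = k' \<and> k = j'"
      using assms inj_x by (auto simp: doubleton_eq_iff inj_on_eq_iff)
    then show "c = - a j k" using c(4) sym by auto
  qed
  then show ?thesis using True by (simp add: conductance_def \<gamma>0_def)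
next
  case False
  then show ?thesis using nonadjacent[OF assms] by (simp add: conductance_def)
qed

lemma diagonal: "j < N \<Longrightarrow> (\<Sum>k\<in>{..<N} - {j}. a j k) = - a j j"
  using row_sum[of j] by (simp add: sum.remove[of "{..<N}" j])

text \<open>Only the diagonal needs an argument: it is where the vanishing row sums enter.\<close>

lemma network_matrix_\<gamma>0: "network_matrix E N B x \<gamma>0 = L"
proof (rule eq_matI)
  fix j k assume "j < dim_row L" "k < dim_col L"
  then have jk: "j < N" "k < N" by (simp_all add: L_def)
  have "(\<Sum>i\<in>{..<N} - {j}. conductance E x \<gamma>0 j i) = a j j"
    using jk diagonal[of j] by (simp add: conductance_\<gamma>0 sum_negf)
  then show "network_matrix E N B x \<gamma>0 $$ (j, k) = L $$ (j, k)"
    using jk by (auto simp: network_matrix_def L_def conductance_\<gamma>0)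
qed (simp_all add: network_matrix_def L_def)

text \<open>Equal matrices give the same potential \<open>u\<close>, and the two expressions for the
  current at \<open>j\<close> differ by \<open>u j\<close> times a zero row sum.\<close>

lemma network_DN_\<gamma>0: "network_DN E N B x \<gamma>0 f = DN f"
proof -
  define u where "u = vec_index (dirichlet_solution N B L f)"
  have "(\<Sum>k\<in>{..<N} - {j}. conductance E x \<gamma>0 j k * (u j - u k)) = (\<Sum>k<N. a j k * u k)"
    if "j < B" for j
  proof -
    have j: "j < N" using that B_le by simp
    have "(\<Sum>k\<in>{..<N} - {j}. conductance E x \<gamma>0 j k * (u j - u k))
        = (\<Sum>k\<in>{..<N} - {j}. a j k * u k - a j k * u j)"
      using j by (intro sum.cong) (auto simp: conductance_\<gamma>0 algebra_simps)
    also have "\<dots> = (\<Sum>k\<in>{..<N} - {j}. a j k * u k) - (\<Sum>k\<in>{..<N} - {j}. a j k) * u j"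
      by (simp add: sum_subtractf sum_distrib_right)
    also have "\<dots> = (\<Sum>k<N. a j k * u k)"
      using j diagonal[OF j] by (simp add: sum.remove[of "{..<N}" j])
    finally show ?thesis .
  qed
  then show ?thesis
    unfolding network_DN_def network_matrix_\<gamma>0 Let_def DN_def u_def by (intro eq_vecI) auto
qed

text \<open>
  The rows of the matrix determine the conductances of all edges with an interior end. Those of an
  edge between boundary vertices do not occur there; they are read off the response at one end to a
  unit potential at the other.
\<close>

lemma conductance_unique:
  assumes M: "network_matrix E N B x \<gamma> = L" and D: "\<And>f. f \<in> carrier_vec B \<Longrightarrow> network_DN E N B x \<gamma> f = DN f"
    and jk: "j < N" "k < N" "j \<noteq> k"
  shows "conductance E x \<gamma> j k = - a j k"
proof -
  have csym: "conductance E x \<gamma> j k = conductance E x \<gamma> k j" for j k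
    by (simp add: conductance_def insert_commute)
  have interior: "conductance E x \<gamma> j k = - a j k" if "B \<le> j" "j < N" "k < N" "j \<noteq> k" for j k
  proof -
    have "network_matrix E N B x \<gamma> $$ (j, k) = L $$ (j, k)" using M by simp
    then show ?thesis using that by (simp add: network_matrix_def L_def)
  qed
  consider "B \<le> j" | "B \<le> k" | "j < B" "k < B" by linarith
  then show ?thesis
  proof cases
    case 1
    then show ?thesis using interior jk by blast
  next
    case 2
    then show ?thesis using interior[of k j] jk csym sym by metis
  next
    case 3
    define f :: "real Matrix.vec" where "f = unit_vec B k"
    have f: "f \<in> carrier_vec B" by (simp add: f_def)
    define u where "u = vec_index (dirichlet_solution N B L f)"
    have u: "u i = (if i = k then 1 else 0)" if "i < B" for i
      using dirichlet_solution_boundary[OF f that] that 3 by (simp add: u_def f_def)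
    \<comment> \<open>Both networks have the matrix \<open>L\<close>, hence the same potential
      \<open>u\<close>, so their currents at \<open>j\<close> differ only through
      \<open>d\<close>.\<close>
    define d where "d i = conductance E x \<gamma> j i - conductance E x \<gamma>0 j i" for i
    have d: "d i = 0" if "B \<le> i" "i < N" for i
    proof -
      have "conductance E x \<gamma> j i = - a j i"
        using interior[of i j] that 3 jk csym[of j i] sym[of j i] by simp
      then show ?thesis using conductance_\<gamma>0[of j i] that 3 jk by (simp add: d_def)
    qed
    have "network_DN E N B x \<gamma> f = network_DN E N B x \<gamma>0 f"
      using D[OF f] network_DN_\<gamma>0 by simp
    then have "vec_index (network_DN E N B x \<gamma> f) j = vec_index (network_DN E N B x \<gamma>0 f) j"
      by simp
    then have "(\<Sum>i\<in>{..<N} - {j}. conductance E x \<gamma> j i * (u j - u i)) =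
        (\<Sum>i\<in>{..<N} - {j}. conductance E x \<gamma>0 j i * (u j - u i))"
      using 3 by (simp add: network_DN_def Let_def M network_matrix_\<gamma>0 u_def)
    then have "(\<Sum>i\<in>{..<N} - {j}. d i * (u j - u i)) = 0"
      by (simp add: d_def left_diff_distrib sum_subtractf)
    \<comment> \<open>For interior \<open>i\<close> the factor \<open>d i\<close> is zero; on the
      boundary \<open>u\<close> is 1 at \<open>k\<close> and 0 elsewhere, in particular at
      \<open>j\<close>. Only \<open>i = k\<close> survives.\<close>
    moreover have "d i * (u j - u i) = (if i = k then - d k else 0)" if "i \<in> {..<N} - {j}" for i
      using that u[of i] u[of j] d[of i] 3 jk by (cases "i < B") auto
    ultimately have "(\<Sum>i\<in>{..<N} - {j}. if i = k then - d k else 0) = 0"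
      by simp
    then have "d k = 0" using jk by simp
    then show ?thesis using conductance_\<gamma>0[OF jk] by (simp add: d_def)
  qed
qed

text \<open>Functions on \<open>E\<close> are total functions fixed to \<open>undefined\<close>
  outside \<open>E\<close>, as \<open>\<rightarrow>\<^sub>E\<close> demands, so uniqueness reduces
  to the values on edges.\<close>

theorem ex1_network:
  "\<exists>!\<gamma>. \<gamma> \<in> E \<rightarrow>\<^sub>E (UNIV :: real set) \<and> network_matrix E N B x \<gamma> = L \<and>
    (\<forall>f\<in>carrier_vec B. network_DN E N B x \<gamma> f = DN f)"
proof (rule ex1I[of _ \<gamma>0])
  show "\<gamma>0 \<in> E \<rightarrow>\<^sub>E UNIV \<and> network_matrix E N B x \<gamma>0 = L \<and>
    (\<forall>f\<in>carrier_vec B. network_DN E N B x \<gamma>0 f = DN f)"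
    using network_matrix_\<gamma>0 network_DN_\<gamma>0 by (auto simp: \<gamma>0_def)
next
  fix \<gamma>
  assume \<gamma>: "\<gamma> \<in> E \<rightarrow>\<^sub>E UNIV \<and> network_matrix E N B x \<gamma> = L \<and>
    (\<forall>f\<in>carrier_vec B. network_DN E N B x \<gamma> f = DN f)"
  show "\<gamma> = \<gamma>0"
  proof (rule PiE_ext[of _ E "\<lambda>_. UNIV"])
    show "\<gamma> \<in> E \<rightarrow>\<^sub>E UNIV" "\<gamma>0 \<in> E \<rightarrow>\<^sub>E UNIV" using \<gamma> by (auto simp: \<gamma>0_def)
    fix e assume e: "e \<in> E"
    then obtain j k where jk: "j < N" "k < N" "j \<noteq> k" "e = {x j, x k}" using edges by blast
    then have "conductance E x \<gamma> j k = conductance E x \<gamma>0 j k"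
      using conductance_unique \<gamma> conductance_\<gamma>0 by metis
    then show "\<gamma> e = \<gamma>0 e" using e jk(4) by (simp add: conductance_def)
  qed
qed

end

section \<open>Application to triangulated polygons\<close>

lemma open_simple_polygon_interior:
  assumes "simple_polygon_interior \<Omega>"
  shows "open \<Omega>"
proof -
  obtain ps where "simple_path (polygonal_path ps)" "\<Omega> = inside (path_image (polygonal_path ps))"
    using assms unfolding simple_polygon_interior_def Let_def by blast
  then show ?thesis
    using open_inside closed_path_image simple_path_imp_path by blast
qed

text \<open>Invertibility is asserted as well because both Dirichlet-to-Neumann maps rest on
  \<open>dirichlet_solution\<close>, which is meaningful only for an invertible matrix.\<close>

theorem theorem1p1:
  fixes \<Omega> :: "(real^2) set" and T :: "(real^2) set set"
    and N B :: nat and x :: "nat \<Rightarrow> real^2"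
    and \<sigma> :: "real^2 \<Rightarrow> real^2^2"
  assumes "simple_polygon_interior \<Omega>"
    and "triangulation_of T \<Omega>"
    and "vertex_labelling \<Omega> T N B x"
    and "\<sigma> \<in> PC_plus \<Omega> T"
  shows "invertible_mat (fem_matrix \<Omega> T N B x \<sigma>) \<and>
    (\<exists>!\<gamma>. \<gamma> \<in> tri_edges T \<rightarrow>\<^sub>E (UNIV :: real set) \<and>
       network_matrix (tri_edges T) N B x \<gamma> = fem_matrix \<Omega> T N B x \<sigma> \<and>
       (\<forall>f\<in>carrier_vec B.
          network_DN (tri_edges T) N B x \<gamma> f = fem_DN \<Omega> T N B x \<sigma> f))"
proof -
  interpret planar_conductivity \<Omega> T N B x \<sigma>
    by (intro planar_conductivity.intro planar_triangulation.intro
        planar_conductivity_axioms.intro open_simple_polygon_interior assms)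
  interpret net: stiffness_network form "tri_edges T" N B x
  proof
    show "\<exists>j<N. \<exists>k<N. j \<noteq> k \<and> e = {x j, x k}" if e: "e \<in> tri_edges T" for e
    proof -
      obtain p q t where t: "t \<in> T" "e = {p, q}" "closed_segment p q edge_of t"
        using e unfolding tri_edges_def by blast
      note ends = edge_of_segment_endpoints[OF t(3)]
      obtain j k where "j < N" "p = x j" "k < N" "q = x k"
        using vertex_index[OF t(1) ends(1)] vertex_index[OF t(1) ends(2)] by metis
      then show ?thesis using ends(3) t(2) by blast
    qed
  qed (fact B_le_N x_inj form_sym form_row_sum form_nonadjacent form_dirichlet_definite)+
  have "fem_matrix \<Omega> T N B x \<sigma> = net.L"
    by (simp add: fem_matrix_def net.L_def)
  moreover from this have "fem_DN \<Omega> T N B x \<sigma> f = net.DN f" for f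
    by (simp add: fem_DN_def net.DN_def)
  ultimately show ?thesis
    using net.invertible_L net.ex1_network by simp
qed

end
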